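(* Let $0\le\alpha<1$ and let $p\ge q\ge2$ and $n$ be integers with $p+q\le n-1$. Then $\lambda_\alpha(B^2_{n,p,q})\ge\lambda_\alpha(B^1_{n,p,q})$, with equality if and only if $p=q$.
   Context: All digraphs are simple. For a digraph $G$, $A(G)$ is its adjacency matrix and $D(G)$ the diagonal matrix of outdegrees; $A_\alpha(G)=\alpha D(G)+(1-\alpha)A(G)$ and $\lambda_\alpha(G)$ is the largest modulus of an eigenvalue of $A_\alpha(G)$. $\overleftrightarrow{K_{p,q}}$ is the complete bipartite digraph obtained from $K_{p,q}$ by replacing each edge with a pair of opposite arcs, with parts $V_p=\{v_1,\ldots,v_p\}$ and $V_q=\{v_{p+1},\ldots,v_{p+q}\}$; let $v_{p+q+1},\ldots,v_n$ be new vertices. $B^1_{n,p,q}$ is obtained from $\overleftrightarrow{K_{p,q}}$ by adding the directed path $v_1v_{p+q+1}v_{p+q+2}\cdots v_nv_p$; $B^2_{n,p,q}$ is obtained by adding the directed path $v_{p+1}v_{p+q+1}v_{p+q+2}\cdots v_nv_{p+q}$. *)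

theory Defs
  imports
    "Graph_Theory.Pair_Digraph"
    "Graph_Theory.Vertex_Walk"
    "Jordan_Normal_Form.Spectral_Radius"
begin

text \<open>A \<^typ>\<open>'a pair_pre_digraph\<close> has no parallel arcs by construction. Matrices are
  0-indexed, so row and column \<open>i\<close> belong to the \<open>i\<close>-th smallest vertex; for vertex set
  \<open>{1..n}\<close> this is vertex \<open>Suc i\<close>.\<close>

definition nth_vertex :: "'a::linorder pair_pre_digraph \<Rightarrow> nat \<Rightarrow> 'a" where
  "nth_vertex G i = sorted_list_of_set (pverts G) ! i"

definition adjacency_matrix :: "'a::linorder pair_pre_digraph \<Rightarrow> real mat" where
  "adjacency_matrix G = mat (card (pverts G)) (card (pverts G))
     (\<lambda>(i, j). if (nth_vertex G i, nth_vertex G j) \<in> parcs G then 1 else 0)"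

definition outdegree_matrix :: "'a::linorder pair_pre_digraph \<Rightarrow> real mat" where
  "outdegree_matrix G = mat (card (pverts G)) (card (pverts G))
     (\<lambda>(i, j). if i = j then real (out_degree (with_proj G) (nth_vertex G i)) else 0)"

definition A_alpha :: "real \<Rightarrow> 'a::linorder pair_pre_digraph \<Rightarrow> real mat" where
  "A_alpha \<alpha> G = \<alpha> \<cdot>\<^sub>m outdegree_matrix G + (1 - \<alpha>) \<cdot>\<^sub>m adjacency_matrix G"

definition lambda_alpha :: "real \<Rightarrow> 'a::linorder pair_pre_digraph \<Rightarrow> real" where
  "lambda_alpha \<alpha> G = spectral_radius (map_mat complex_of_real (A_alpha \<alpha> G))"

text \<open>The vertex \<open>v\<^sub>i\<close> is the number \<open>i\<close>.\<close>

definition complete_bipartite_digraph :: "nat \<Rightarrow> nat \<Rightarrow> nat pair_pre_digraph" where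
  "complete_bipartite_digraph p q =
     \<lparr> pverts = {1..p + q},
       parcs = {1..p} \<times> {p + 1..p + q} \<union> {p + 1..p + q} \<times> {1..p} \<rparr>"

definition add_directed_path :: "'a pair_pre_digraph \<Rightarrow> 'a list \<Rightarrow> 'a pair_pre_digraph" where
  "add_directed_path G vs =
     \<lparr> pverts = pverts G \<union> set vs, parcs = parcs G \<union> set (vwalk_arcs vs) \<rparr>"

definition B1 :: "nat \<Rightarrow> nat \<Rightarrow> nat \<Rightarrow> nat pair_pre_digraph" where
  "B1 n p q = add_directed_path (complete_bipartite_digraph p q)
     (1 # [p + q + 1..<n + 1] @ [p])"

definition B2 :: "nat \<Rightarrow> nat \<Rightarrow> nat \<Rightarrow> nat pair_pre_digraph" where
  "B2 n p q = add_directed_path (complete_bipartite_digraph p q)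
     ((p + 1) # [p + q + 1..<n + 1] @ [p + q])"

lemma pverts_B1:
  assumes "p \<ge> 2" "q \<ge> 2" "p + q \<le> n - 1"
  shows "pverts (B1 n p q) = {1..n}"
  using assms by (auto simp: B1_def add_directed_path_def complete_bipartite_digraph_def)

lemma pverts_B2:
  assumes "p \<ge> 2" "q \<ge> 2" "p + q \<le> n - 1"
  shows "pverts (B2 n p q) = {1..n}"
  using assms by (auto simp: B2_def add_directed_path_def complete_bipartite_digraph_def)

lemma nth_vertex_atLeastAtMost:
  assumes "pverts G = {1..n}" "i < n"
  shows "nth_vertex G i = Suc i"
proof -
  have "sorted_list_of_set {1..n} = [1..<Suc n]"
    by (metis atLeastLessThanSuc_atLeastAtMost sorted_list_of_set_range)
  with assms show ?thesis by (simp add: nth_vertex_def del: upt_Suc)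
qed

lemma vwalk_arcs_distinctD:
  assumes "distinct vs" "(x, y) \<in> set (vwalk_arcs vs)"
  shows "x \<in> set vs \<and> y \<in> set vs \<and> x \<noteq> y"
  using assms by (induction vs rule: vwalk_arcs.induct) auto

lemma pair_digraph_add_directed_path:
  assumes "pair_digraph G" "distinct vs"
  shows "pair_digraph (add_directed_path G vs)"
proof -
  interpret pair_digraph G by fact
  show ?thesis
  proof
    fix e assume "e \<in> parcs (add_directed_path G vs)"
    then consider "e \<in> parcs G" | "e \<in> set (vwalk_arcs vs)"
      by (auto simp: add_directed_path_def)
    then have "fst e \<in> pverts G \<union> set vs \<and> snd e \<in> pverts G \<union> set vs \<and> fst e \<noteq> snd e"
    proof cases
      case 1
      then show ?thesis using arc_fst_in_verts arc_snd_in_verts pair_no_loops by blast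
    next
      case 2
      then show ?thesis using vwalk_arcs_distinctD[OF assms(2), of "fst e" "snd e"] by simp
    qed
    then show "fst e \<in> pverts (add_directed_path G vs)"
      and "snd e \<in> pverts (add_directed_path G vs)" and "fst e \<noteq> snd e"
      by (simp_all add: add_directed_path_def)
  qed (simp_all add: add_directed_path_def pair_finite_verts pair_finite_arcs)
qed

lemma pair_digraph_complete_bipartite:
  "pair_digraph (complete_bipartite_digraph p q)"
  by unfold_locales (auto simp: complete_bipartite_digraph_def)

lemma pair_digraph_B1:
  assumes "p \<ge> 2"
  shows "pair_digraph (B1 n p q)"
  unfolding B1_def
  by (rule pair_digraph_add_directed_path[OF pair_digraph_complete_bipartite])
    (use assms in auto)

lemma pair_digraph_B2:
  assumes "q \<ge> 2"
  shows "pair_digraph (B2 n p q)"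
  unfolding B2_def
  by (rule pair_digraph_add_directed_path[OF pair_digraph_complete_bipartite])
    (use assms in auto)

end

theory Submission
  imports Defs
begin

text \<open>If \<open>A\<close> is nonnegative and has a positive eigenvector, the corresponding eigenvalue is the
  spectral radius. In \<open>B\<^sup>1\<close> and \<open>B\<^sup>2\<close> such an eigenvector can be written down: let \<open>P\<close> be the part
  that contains the ends of the path, \<open>Q\<close> the other part, \<open>r = |P|\<close>, \<open>s = |Q|\<close>,
  \<open>t = (1 - \<alpha>) / (\<lambda> - \<alpha>)\<close> and \<open>k = n - p - q\<close>. Eliminating variables, the eigenvalue equations
  reduce to
  \<open>(\<lambda> - \<alpha> r) (\<lambda> - \<alpha> s) - (1 - \<alpha>)\<^sup>2 r s = (1 - \<alpha>)\<^sup>2 s (\<alpha> + (1 - \<alpha>) t\<^sup>k) / (\<lambda> - \<alpha> (s + 1))\<close>.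
  Only the right-hand side is not symmetric in \<open>r\<close> and \<open>s\<close>; it is decreasing in \<open>\<lambda>\<close> and
  increasing in \<open>s\<close>, so that its intersection with the increasing left-hand side lies further
  to the right for \<open>s = p\<close> (that is, for \<open>B\<^sup>2\<close>) than for \<open>s = q\<close>.\<close>

section \<open>Positive eigenvectors and the spectral radius\<close>

text \<open>The vector \<open>x\<close> itself puts \<open>l\<close> into the spectrum. For an
  arbitrary eigenvector \<open>v\<close>, row \<open>i\<close> is read at an index where
  \<open>norm (v $ i)\<close> equals its bound \<open>c * x i\<close>; since the row is nonnegative,
  the triangle inequality gives \<open>norm \<mu> * (c * x i) \<le> l * (c * x i)\<close>.\<close>

lemma spectral_radius_eq_of_positive_eigenvector:
  fixes A :: "real mat" and x :: "nat \<Rightarrow> real"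
  assumes A: "A \<in> carrier_mat n n" and n: "n > 0"
    and nonneg: "\<And>i j. i < n \<Longrightarrow> j < n \<Longrightarrow> A $$ (i, j) \<ge> 0"
    and pos: "\<And>i. i < n \<Longrightarrow> x i > 0"
    and eig: "\<And>i. i < n \<Longrightarrow> (\<Sum>j<n. A $$ (i, j) * x j) = l * x i"
  shows "spectral_radius (map_mat complex_of_real A) = l"
proof -
  let ?A = "map_mat complex_of_real A"
  have cA: "?A \<in> carrier_mat n n" using A by simp
  have l0: "l \<ge> 0"
  proof -
    have "0 \<le> (\<Sum>j<n. A $$ (0, j) * x j)"
      using nonneg pos n by (intro sum_nonneg mult_nonneg_nonneg) (auto simp: less_imp_le)
    then show ?thesis using eig[OF n] pos[OF n] by (simp add: zero_le_mult_iff)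
  qed
  have mult: "(?A *\<^sub>v v) $ i = (\<Sum>j<n. of_real (A $$ (i, j)) * v $ j)"
    if "v \<in> carrier_vec n" "i < n" for v i
    using that A by (auto simp: scalar_prod_def lessThan_atLeast0 intro!: sum.cong)
  have mem: "complex_of_real l \<in> spectrum ?A"
  proof -
    let ?v = "vec n (\<lambda>i. complex_of_real (x i))"
    have "?A *\<^sub>v ?v = complex_of_real l \<cdot>\<^sub>v ?v"
    proof (rule eq_vecI)
      fix i assume "i < dim_vec (complex_of_real l \<cdot>\<^sub>v ?v)"
      then have i: "i < n" by simp
      have "(?A *\<^sub>v ?v) $ i = (\<Sum>j<n. complex_of_real (A $$ (i, j) * x j))"
        using i by (subst mult) auto
      also have "\<dots> = complex_of_real (l * x i)"
        using eig[OF i] by (metis of_real_sum)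
      finally show "(?A *\<^sub>v ?v) $ i = (complex_of_real l \<cdot>\<^sub>v ?v) $ i" using i by simp
    qed (use A in auto)
    moreover have "?v \<noteq> 0\<^sub>v n"
    proof
      assume "?v = 0\<^sub>v n"
      then have "?v $ 0 = 0\<^sub>v n $ 0" by simp
      then show False using n pos[OF n] by simp
    qed
    ultimately have "eigenvector ?A ?v (complex_of_real l)"
      using A by (simp add: eigenvector_def)
    then show ?thesis by (auto simp: spectrum_def eigenvalue_def)
  qed
  have bound: "norm \<mu> \<le> l" if "\<mu> \<in> spectrum ?A" for \<mu>
  proof -
    from that obtain v where v: "v \<in> carrier_vec n" "v \<noteq> 0\<^sub>v n" and ev: "?A *\<^sub>v v = \<mu> \<cdot>\<^sub>v v"
      using A by (auto simp: spectrum_def eigenvalue_def eigenvector_def)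
    define f where "f i = norm (v $ i) / x i" for i
    \<comment> \<open>Compare \<open>|v|\<close> with the smallest multiple of \<open>x\<close> that dominates it.\<close>
    define c where "c = Max (f ` {..<n})"
    have "c \<in> f ` {..<n}" unfolding c_def using n by (intro Max_in) auto
    then obtain i where i: "i < n" "c = f i" by auto
    have le: "norm (v $ j) \<le> c * x j" if "j < n" for j
    proof -
      have "f j \<le> c" unfolding c_def using that by simp
      then show ?thesis using pos[OF that] by (simp add: f_def field_simps)
    qed
    have c_pos: "c > 0"
    proof -
      obtain j where j: "j < n" "v $ j \<noteq> 0"
        using v by (metis carrier_vecD eq_vecI index_zero_vec(1,2))
      then have "0 < c * x j" using le[of j] by (smt (verit) zero_less_norm_iff)
      then show ?thesis using pos[OF j(1)] by (simp add: zero_less_mult_iff)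
    qed
    have "norm \<mu> * (c * x i) = norm ((\<mu> \<cdot>\<^sub>v v) $ i)"
      using i pos[OF i(1)] v by (simp add: f_def norm_mult)
    also have "\<dots> = norm (\<Sum>j<n. of_real (A $$ (i, j)) * v $ j)"
      using mult[OF v(1) i(1)] by (simp add: ev)
    also have "\<dots> \<le> (\<Sum>j<n. A $$ (i, j) * norm (v $ j))"
      using nonneg[OF i(1)] by (intro sum_norm_le) (simp add: norm_mult)
    also have "\<dots> \<le> (\<Sum>j<n. A $$ (i, j) * (c * x j))"
      using nonneg[OF i(1)] le by (intro sum_mono mult_left_mono) auto
    also have "\<dots> = c * (\<Sum>j<n. A $$ (i, j) * x j)"
      by (simp add: sum_distrib_left algebra_simps)
    also have "\<dots> = l * (c * x i)" using eig[OF i(1)] by simp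
    finally show ?thesis using c_pos pos[OF i(1)] by simp
  qed
  have "l \<in> norm ` spectrum ?A" using mem l0 by (force simp: image_iff)
  then have "Max (norm ` spectrum ?A) = l"
    using bound card_finite_spectrum(1)[OF cA] by (intro Max_eqI) auto
  then show ?thesis by (simp add: spectral_radius_def)
qed

text \<open>Reindexing along the bijection \<open>nth_vertex\<close> turns each matrix row into a
  condition on one vertex and its out-neighbours, so that the order of the vertices
  disappears.\<close>

lemma lambda_alpha_eq_of_positive_eigenvector:
  fixes G :: "'a::linorder pair_pre_digraph" and x :: "'a \<Rightarrow> real"
  assumes G: "pair_digraph G" and ne: "pverts G \<noteq> {}" and \<alpha>: "0 \<le> \<alpha>" "\<alpha> \<le> 1"
    and pos: "\<And>v. v \<in> pverts G \<Longrightarrow> x v > 0"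
    and eig: "\<And>v. v \<in> pverts G \<Longrightarrow>
      \<alpha> * real (card (parcs G `` {v})) * x v + (1 - \<alpha>) * (\<Sum>w\<in>parcs G `` {v}. x w) = l * x v"
  shows "lambda_alpha \<alpha> G = l"
proof -
  interpret pair_digraph G by fact
  define n where "n = card (pverts G)"
  have bij: "bij_betw (nth_vertex G) {..<n} (pverts G)"
    unfolding nth_vertex_def n_def using pair_finite_verts
    by (intro bij_betw_nth) auto
  then have vert: "nth_vertex G i \<in> pverts G" if "i < n" for i
    using that by (auto simp: bij_betw_def)
  have out_arcs: "out_degree (with_proj G) v = card (parcs G `` {v})" for v
  proof -
    have "out_arcs (with_proj G) v = Pair v ` (parcs G `` {v})"
      by (auto simp: out_arcs_def)
    then show ?thesis by (simp add: out_degree_def card_image inj_on_def)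
  qed
  have entry: "A_alpha \<alpha> G $$ (i, j) =
      \<alpha> * (if i = j then real (card (parcs G `` {nth_vertex G i})) else 0)
      + (1 - \<alpha>) * (if (nth_vertex G i, nth_vertex G j) \<in> parcs G then 1 else 0)"
    if "i < n" "j < n" for i j
    using that by (simp add: A_alpha_def outdegree_matrix_def adjacency_matrix_def n_def out_arcs)
  show ?thesis
    unfolding lambda_alpha_def
  proof (rule spectral_radius_eq_of_positive_eigenvector[where x = "\<lambda>i. x (nth_vertex G i)"])
    show "A_alpha \<alpha> G \<in> carrier_mat n n"
      by (simp add: A_alpha_def outdegree_matrix_def adjacency_matrix_def n_def)
    show "n > 0" using ne pair_finite_verts by (simp add: n_def card_gt_0_iff)
    show "A_alpha \<alpha> G $$ (i, j) \<ge> 0" if "i < n" "j < n" for i j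
      using \<alpha> by (simp add: entry[OF that])
    show "x (nth_vertex G i) > 0" if "i < n" for i using pos vert that by blast
    show "(\<Sum>j<n. A_alpha \<alpha> G $$ (i, j) * x (nth_vertex G j)) = l * x (nth_vertex G i)"
      if i: "i < n" for i
    proof -
      let ?v = "nth_vertex G i"
      have sub: "parcs G `` {?v} \<subseteq> pverts G" using arc_snd_in_verts by force
      have "(\<Sum>j<n. A_alpha \<alpha> G $$ (i, j) * x (nth_vertex G j)) =
        (\<Sum>j<n. (if i = j then \<alpha> * real (card (parcs G `` {?v})) * x ?v else 0)
           + (1 - \<alpha>) * (if nth_vertex G j \<in> parcs G `` {?v} then x (nth_vertex G j) else 0))"
        using i by (intro sum.cong) (auto simp: entry algebra_simps)
      also have "\<dots> = \<alpha> * real (card (parcs G `` {?v})) * x ?v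
          + (1 - \<alpha>) * (\<Sum>j<n. if nth_vertex G j \<in> parcs G `` {?v} then x (nth_vertex G j) else 0)"
        using i by (simp add: sum.distrib sum_distrib_left)
      also have "(\<Sum>j<n. if nth_vertex G j \<in> parcs G `` {?v} then x (nth_vertex G j) else 0)
          = (\<Sum>w\<in>pverts G. if w \<in> parcs G `` {?v} then x w else 0)"
        by (rule sum.reindex_bij_betw[OF bij])
      also have "\<dots> = (\<Sum>w\<in>parcs G `` {?v}. x w)"
        using sum.inter_restrict[OF pair_finite_verts, of x "parcs G `` {?v}"] sub
        by (simp add: Int_absorb1)
      finally show ?thesis using eig[OF vert[OF i]] by simp
    qed
  qed
qed

section \<open>The scalar equation for the eigenvalue\<close>

text \<open>With the eigenvector scaled to 1 on the rest of the part \<open>P\<close>, its entry at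
  the start of the path exceeds 1 by
  \<open>path_weight \<alpha> k l / (l - \<alpha> * (s + 1))\<close>.\<close>

definition path_weight :: "real \<Rightarrow> nat \<Rightarrow> real \<Rightarrow> real" where
  "path_weight \<alpha> k l = \<alpha> + (1 - \<alpha>) * ((1 - \<alpha>) / (l - \<alpha>)) ^ k"

text \<open>The denominator is multiplied out so that the intermediate value theorem may use the
  endpoint where it vanishes. The two inequalities select a root whose eigenvector is
  positive.\<close>

definition dominant_root :: "real \<Rightarrow> nat \<Rightarrow> nat \<Rightarrow> nat \<Rightarrow> real \<Rightarrow> bool" where
  "dominant_root \<alpha> k r s l \<longleftrightarrow> l > 1 \<and> l > \<alpha> * (real s + 1) \<and>
     (l - \<alpha> * (real s + 1)) * ((l - \<alpha> * real r) * (l - \<alpha> * real s) - (1 - \<alpha>)\<^sup>2 * real r * real s)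
       = (1 - \<alpha>)\<^sup>2 * real s * path_weight \<alpha> k l"

lemma path_weight_pos:
  assumes "0 \<le> \<alpha>" "\<alpha> < 1" "l \<ge> 1"
  shows "path_weight \<alpha> k l > 0"
  unfolding path_weight_def using assms by (intro add_nonneg_pos mult_pos_pos) auto

lemma path_weight_antimono:
  assumes "0 \<le> \<alpha>" "\<alpha> < 1" "1 \<le> l" "l \<le> m"
  shows "path_weight \<alpha> k m \<le> path_weight \<alpha> k l"
  unfolding path_weight_def using assms
  by (intro add_left_mono mult_left_mono power_mono divide_left_mono) auto

text \<open>Intermediate value theorem for the difference \<open>g\<close> of the two sides. Since
  \<open>g a\<close> is strictly negative, the zero lies strictly above \<open>a\<close>, which
  yields both inequalities of \<open>dominant_root\<close>.\<close>

lemma dominant_root_exists: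
  assumes \<alpha>: "0 \<le> \<alpha>" "\<alpha> < 1" and rs: "r \<ge> 1" "s \<ge> 1"
  shows "\<exists>l. dominant_root \<alpha> k r s l"
proof -
  define g where "g l = (l - \<alpha> * (real s + 1)) *
      ((l - \<alpha> * real r) * (l - \<alpha> * real s) - (1 - \<alpha>)\<^sup>2 * real r * real s)
      - (1 - \<alpha>)\<^sup>2 * real s * path_weight \<alpha> k l" for l
  define a where "a = max 1 (\<alpha> * (real s + 1))"
  \<comment> \<open>Chosen so that \<open>b - \<alpha> * r\<close> and
    \<open>b - \<alpha> * (s + 1)\<close> are at least 1, while \<open>b - \<alpha> * s\<close> is
    at least \<open>r * s\<close> plus the bound \<open>s * path_weight \<alpha> k 1\<close> for the
    right-hand side.\<close>
  define b where "b = real r + real s + 2 + real r * real s + real s * path_weight \<alpha> k 1"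
  have ga: "g a < 0"
  proof -
    have "(a - \<alpha> * (real s + 1)) *
      ((a - \<alpha> * real r) * (a - \<alpha> * real s) - (1 - \<alpha>)\<^sup>2 * real r * real s) \<le> 0"
    \<comment> \<open>Either \<open>a = 1\<close>, where
      \<open>1 - \<alpha> * r \<le> (1 - \<alpha>) * r\<close> and its analogue for \<open>s\<close>
      make the quadratic factor nonpositive, or \<open>a = \<alpha> * (s + 1)\<close> and the linear
      factor vanishes.\<close>
    proof (cases "\<alpha> * (real s + 1) \<le> 1")
      case True
      then have a: "a = 1" by (simp add: a_def)
      have "1 - \<alpha> * real s \<ge> 0" using True \<alpha> by (simp add: algebra_simps)
      moreover have "1 - \<alpha> * real r \<le> (1 - \<alpha>) * real r" "1 - \<alpha> * real s \<le> (1 - \<alpha>) * real s"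
        using rs by (simp_all add: algebra_simps)
      ultimately have "(1 - \<alpha> * real r) * (1 - \<alpha> * real s) \<le> ((1 - \<alpha>) * real r) * ((1 - \<alpha>) * real s)"
        using \<alpha> by (intro mult_mono) auto
      then show ?thesis using True
        by (intro mult_nonneg_nonpos) (auto simp: a power2_eq_square algebra_simps)
    next
      case False
      then show ?thesis by (simp add: a_def)
    qed
    moreover have "(1 - \<alpha>)\<^sup>2 * real s * path_weight \<alpha> k a > 0"
      using path_weight_pos[OF \<alpha>, of a k] \<alpha> rs by (simp add: a_def)
    ultimately show ?thesis by (simp add: g_def)
  qed
  have \<alpha>r: "\<alpha> * real r \<le> real r" and \<alpha>s: "\<alpha> * real s \<le> real s" "\<alpha> * (real s + 1) \<le> real s + 1"
    using \<alpha> by (simp_all add: mult_left_le_one_le)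
  have w: "real s * path_weight \<alpha> k 1 \<ge> 0"
    using path_weight_pos[OF \<alpha>, of 1 k] by simp
  have rs0: "real r * real s \<ge> 0" by simp
  have ab: "a \<le> b" unfolding a_def b_def using \<alpha>s rs0 w by linarith
  have b1: "b \<ge> 1" using rs0 w by (simp add: b_def)
  have sq: "(1 - \<alpha>)\<^sup>2 \<le> 1" using \<alpha> by (simp add: power_le_one)
  have gb: "g b \<ge> 0"
  proof -
    let ?c = "real r * real s + real s * path_weight \<alpha> k 1"
    have "?c = 1 * ?c" by simp
    also have "\<dots> \<le> (b - \<alpha> * real r) * (b - \<alpha> * real s)"
      unfolding b_def using \<alpha>r \<alpha>s w rs0 by (intro mult_mono; linarith)
    finally have 1: "?c \<le> (b - \<alpha> * real r) * (b - \<alpha> * real s)" .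
    have 2: "(1 - \<alpha>)\<^sup>2 * real r * real s \<le> real r * real s"
      using mult_right_mono[OF sq rs0] by (simp add: mult.assoc)
    have "(1 - \<alpha>)\<^sup>2 * real s * path_weight \<alpha> k b \<le> 1 * real s * path_weight \<alpha> k 1"
      using path_weight_antimono[OF \<alpha>, of 1 b k] path_weight_pos[OF \<alpha> b1, of k] b1 sq
      by (intro mult_mono) auto
    also have "\<dots> \<le> 1 * ((b - \<alpha> * real r) * (b - \<alpha> * real s) - (1 - \<alpha>)\<^sup>2 * real r * real s)"
      using 1 2 by simp
    also have "\<dots> \<le> (b - \<alpha> * (real s + 1)) *
        ((b - \<alpha> * real r) * (b - \<alpha> * real s) - (1 - \<alpha>)\<^sup>2 * real r * real s)"
      using 1 2 w rs0 \<alpha>s b_def by (intro mult_right_mono; linarith)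
    finally show ?thesis by (simp add: g_def)
  qed
  have "continuous_on {a..b} g"
    unfolding g_def path_weight_def using \<alpha> by (intro continuous_intros) (auto simp: a_def)
  then obtain l where l: "a \<le> l" "l \<le> b" "g l = 0"
    using IVT'[of g a 0 b] ga gb ab by auto
  then have "a < l" using ga by (cases "a = l") auto
  then have "dominant_root \<alpha> k r s l"
    using l(3) by (simp add: dominant_root_def a_def g_def)
  then show ?thesis ..
qed

text \<open>The right-hand side is positive, hence so is the quadratic factor, and with it the
  product of \<open>l - \<alpha> * r\<close> and \<open>l - \<alpha> * s\<close>; the second of
  these is positive by definition of the root.\<close>

lemma dominant_root_factors_pos:
  assumes \<alpha>: "0 \<le> \<alpha>" "\<alpha> < 1" and rs: "r \<ge> 1" "s \<ge> 1" and l: "dominant_root \<alpha> k r s l"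
  shows "l > \<alpha> * real r" "l > \<alpha> * real s"
proof -
  have l1: "l > 1" and ls: "l > \<alpha> * (real s + 1)" using l by (simp_all add: dominant_root_def)
  show s: "l > \<alpha> * real s" using ls \<alpha> by (simp add: algebra_simps)
  have "(1 - \<alpha>)\<^sup>2 * real s * path_weight \<alpha> k l > 0"
    using path_weight_pos[OF \<alpha>, of l k] \<alpha> rs l1 by simp
  then have "(l - \<alpha> * real r) * (l - \<alpha> * real s) - (1 - \<alpha>)\<^sup>2 * real r * real s > 0"
    using l ls unfolding dominant_root_def by (metis diff_gt_0_iff_gt zero_less_mult_pos)
  moreover have "(1 - \<alpha>)\<^sup>2 * real r * real s \<ge> 0" by simp
  ultimately have "(l - \<alpha> * real r) * (l - \<alpha> * real s) > 0" by linarith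
  then show "l > \<alpha> * real r" using s by (simp add: zero_less_mult_iff)
qed

text \<open>If \<open>m \<le> l\<close>, monotonicity carries the equation of \<open>m\<close> over
  to \<open>l\<close> as an inequality. Eliminating the path weight between it and the equation of
  \<open>l\<close> leaves a contradiction to \<open>q < p\<close>.\<close>

lemma dominant_root_swap_less:
  assumes \<alpha>: "0 \<le> \<alpha>" "\<alpha> < 1" and q: "q \<ge> 1" and pq: "q < p"
    and l: "dominant_root \<alpha> k p q l" and m: "dominant_root \<alpha> k q p m"
  shows "l < m"
proof (rule ccontr)
  assume "\<not> l < m"
  then have ml: "m \<le> l" by simp
  have m1: "m > 1" and mp: "m > \<alpha> * (real p + 1)"
    using m by (simp_all add: dominant_root_def)
  have lq: "l > \<alpha> * (real q + 1)" using l by (simp add: dominant_root_def)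
  have lp: "l > \<alpha> * (real p + 1)" using mp ml by simp
  \<comment> \<open>The factor common to both equations, symmetric in \<open>p\<close> and
    \<open>q\<close>.\<close>
  define F where "F x = (x - \<alpha> * real p) * (x - \<alpha> * real q) - (1 - \<alpha>)\<^sup>2 * real p * real q" for x
  have w: "path_weight \<alpha> k l > 0" "path_weight \<alpha> k l \<le> path_weight \<alpha> k m"
    using \<alpha> m1 ml by (auto intro: path_weight_pos path_weight_antimono)
  have eq_l: "(l - \<alpha> * (real q + 1)) * F l = (1 - \<alpha>)\<^sup>2 * real q * path_weight \<alpha> k l"
    using l by (simp add: dominant_root_def F_def)
  have eq_m: "(m - \<alpha> * (real p + 1)) * F m = (1 - \<alpha>)\<^sup>2 * real p * path_weight \<alpha> k m"
    using m by (simp add: dominant_root_def F_def algebra_simps)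
  have Fm: "F m > 0"
  proof -
    have "(m - \<alpha> * (real p + 1)) * F m > 0"
      unfolding eq_m using w \<alpha> pq by simp
    then show ?thesis using mp by (simp add: zero_less_mult_iff)
  qed
  \<comment> \<open>Both linear factors of the product are positive at \<open>m\<close>, so the
    product grows from \<open>m\<close> to \<open>l\<close>.\<close>
  have "F m \<le> F l"
    unfolding F_def using ml \<alpha> dominant_root_factors_pos[OF \<alpha> _ _ m] q pq
    by (intro diff_right_mono mult_mono) auto
  then have "(m - \<alpha> * (real p + 1)) * F m \<le> (l - \<alpha> * (real p + 1)) * F l"
    using ml mp lp Fm by (intro mult_mono) auto
  moreover have "(1 - \<alpha>)\<^sup>2 * real p * path_weight \<alpha> k l \<le> (1 - \<alpha>)\<^sup>2 * real p * path_weight \<alpha> k m"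
    using w by (intro mult_left_mono) auto
  ultimately have le: "(1 - \<alpha>)\<^sup>2 * real p * path_weight \<alpha> k l \<le> (l - \<alpha> * (real p + 1)) * F l"
    using eq_m by simp
  have "real p * ((l - \<alpha> * (real q + 1)) * F l) = real q * ((1 - \<alpha>)\<^sup>2 * real p * path_weight \<alpha> k l)"
    unfolding eq_l by simp
  also have "\<dots> \<le> real q * ((l - \<alpha> * (real p + 1)) * F l)"
    using le by (intro mult_left_mono) auto
  finally have "(real p * (l - \<alpha> * (real q + 1)) - real q * (l - \<alpha> * (real p + 1))) * F l \<le> 0"
    by (simp add: algebra_simps)
  \<comment> \<open>The terms \<open>\<alpha> * p * q\<close> cancel.\<close>
  moreover have "real p * (l - \<alpha> * (real q + 1)) - real q * (l - \<alpha> * (real p + 1))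
      = (real p - real q) * (l - \<alpha>)"
    by (simp add: algebra_simps)
  ultimately have "(real p - real q) * (l - \<alpha>) * F l \<le> 0" by simp
  moreover have "(real p - real q) * (l - \<alpha>) * F l > 0"
    using pq m1 ml \<alpha> Fm \<open>F m \<le> F l\<close> by (intro mult_pos_pos) auto
  ultimately show False by simp
qed

section \<open>The eigenvector of a bipartite digraph with a path\<close>

text \<open>The path runs from \<open>u\<close> to \<open>v\<close>, both in \<open>P\<close>;
  keeping \<open>P\<close> and \<open>Q\<close> abstract covers both digraphs. The eigenvector is
  scaled to be 1 on \<open>P - {u}\<close>, in particular at \<open>v\<close>.\<close>

lemma lambda_alpha_bipartite_with_path:
  fixes G :: "nat pair_pre_digraph"
  assumes G: "pair_digraph G" "pverts G = P \<union> Q \<union> {m<..n}"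
    and \<alpha>: "0 \<le> \<alpha>" "\<alpha> < 1" and mn: "m < n"
    and PQ: "P \<inter> Q = {}" "P \<subseteq> {..m}" "Q \<subseteq> {..m}" "Q \<noteq> {}"
    and uv: "u \<in> P" "v \<in> P" "u \<noteq> v"
    and out: "\<And>w. w \<in> P - {u} \<Longrightarrow> parcs G `` {w} = Q" "parcs G `` {u} = insert (Suc m) Q"
      "\<And>w. w \<in> Q \<Longrightarrow> parcs G `` {w} = P"
      "\<And>j. m < j \<Longrightarrow> j < n \<Longrightarrow> parcs G `` {j} = {Suc j}" "parcs G `` {n} = {v}"
    and l: "dominant_root \<alpha> (n - m) (card P) (card Q) l"
  shows "lambda_alpha \<alpha> G = l"
proof -
  define r s where "r = real (card P)" and "s = real (card Q)"
  \<comment> \<open>\<open>t\<close>, \<open>y\<close> and \<open>z\<close> solve the equations at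
    \<open>n\<close>, at \<open>u\<close> and on \<open>P - {u}\<close>, respectively. A path vertex
    \<open>w\<close> is \<open>Suc n - w\<close> arcs away from \<open>v\<close>, whence the
    exponent in \<open>x\<close>.\<close>
  define t where "t = (1 - \<alpha>) / (l - \<alpha>)"
  define y where "y = (l - \<alpha> * s + (1 - \<alpha>) * t ^ (n - m)) / (l - \<alpha> * (s + 1))"
  define z where "z = (l - \<alpha> * s) / ((1 - \<alpha>) * s)"
  define x where "x w = (if w = u then y else if w \<in> P then 1 else if w \<in> Q then z
    else t ^ (Suc n - w))" for w
  have fin: "finite P" "finite Q" using PQ by (auto intro: finite_subset)
  have card1: "card P \<ge> 1" "card Q \<ge> 1"
    using fin uv PQ by (auto simp: Suc_le_eq card_gt_0_iff)
  have l1: "l > 1" and ls1: "l > \<alpha> * (s + 1)" using l by (simp_all add: dominant_root_def s_def)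
  have ls: "l > \<alpha> * s"
    using dominant_root_factors_pos[OF \<alpha> card1 l] by (simp_all add: s_def)
  have s0: "s > 0" using card1 by (simp add: s_def)
  have t0: "t > 0" using \<alpha> l1 by (simp add: t_def)
  have y0: "y > 0" unfolding y_def using ls ls1 t0 \<alpha> by (intro divide_pos_pos add_pos_pos) auto
  have z0: "z > 0" unfolding z_def using ls \<alpha> s0 by simp
  have t_eq: "\<alpha> * t + (1 - \<alpha>) = l * t"
    using \<alpha> l1 by (simp add: t_def field_simps)
  have z_eq: "(1 - \<alpha>) * (s * z) = l - \<alpha> * s"
    using \<alpha> s0 by (simp add: z_def)
  have y_eq: "(l - \<alpha> * (s + 1)) * y = l - \<alpha> * s + (1 - \<alpha>) * t ^ (n - m)"
    using ls1 by (simp add: y_def)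
  have sumQ: "(\<Sum>w\<in>Q. x w) = s * z"
  proof -
    have "(\<Sum>w\<in>Q. x w) = (\<Sum>w\<in>Q. z)" using PQ uv by (intro sum.cong) (auto simp: x_def)
    then show ?thesis by (simp add: s_def)
  qed
  have sumP: "(\<Sum>w\<in>P. x w) = y + (r - 1)"
  proof -
    have "(\<Sum>w\<in>P. x w) = x u + (\<Sum>w\<in>P - {u}. x w)" using fin uv by (simp add: sum.remove)
    also have "(\<Sum>w\<in>P - {u}. x w) = (\<Sum>w\<in>P - {u}. 1)" by (intro sum.cong) (auto simp: x_def)
    finally show ?thesis using fin uv card1 by (simp add: x_def r_def of_nat_diff)
  qed
  have xpath: "x j = t ^ (Suc n - j)" if "m < j" for j
    using that PQ uv by (auto simp: x_def)
  have Sm: "Suc m \<notin> Q" using PQ by auto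
  have root: "(l - \<alpha> * (s + 1)) * ((l - \<alpha> * r) * (l - \<alpha> * s) - (1 - \<alpha>)\<^sup>2 * r * s)
      = (1 - \<alpha>)\<^sup>2 * s * (\<alpha> + (1 - \<alpha>) * t ^ (n - m))"
    using l by (simp add: dominant_root_def path_weight_def r_def s_def t_def)
  \<comment> \<open>The one equation not built into \<open>t\<close>, \<open>y\<close> and
    \<open>z\<close>: after clearing the denominators of \<open>y\<close> and \<open>z\<close>, it
    is the equation of \<open>dominant_root\<close>.\<close>
  have Q_eq: "\<alpha> * r * z + (1 - \<alpha>) * (y + (r - 1)) = l * z"
  proof -
    have "(l - \<alpha> * (s + 1)) * ((l - \<alpha> * r) * ((1 - \<alpha>) * (s * z)))
        = (1 - \<alpha>)\<^sup>2 * s * ((l - \<alpha> * (s + 1)) * y + (r - 1) * (l - \<alpha> * (s + 1)))"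
      unfolding z_eq y_eq using root by (simp add: algebra_simps)
    then have "(l - \<alpha> * (s + 1)) * (1 - \<alpha>) * s * ((l - \<alpha> * r) * z - (1 - \<alpha>) * (y + (r - 1))) = 0"
      by (simp add: algebra_simps power2_eq_square)
    then have "(l - \<alpha> * r) * z - (1 - \<alpha>) * (y + (r - 1)) = 0"
      using ls1 \<alpha> s0 by simp
    then show ?thesis by (simp add: algebra_simps)
  qed
  show ?thesis
  proof (rule lambda_alpha_eq_of_positive_eigenvector[where x = x])
    show "x w > 0" if "w \<in> pverts G" for w using y0 z0 t0 by (simp add: x_def)
    show "\<alpha> * real (card (parcs G `` {w})) * x w + (1 - \<alpha>) * (\<Sum>w\<in>parcs G `` {w}. x w) = l * x w"
      if w: "w \<in> pverts G" for w
    proof -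
      consider "w \<in> P - {u}" | "w = u" | "w \<in> Q" | "m < w" "w < n" | "w = n"
        using w G(2) by fastforce
      then show ?thesis
      proof cases
        case 1
        then have "x w = 1" by (auto simp: x_def)
        then show ?thesis using out(1)[OF 1] z_eq by (simp add: sumQ s_def)
      next
        case 2
        have "x u = y" by (simp add: x_def)
        moreover have "real (card (insert (Suc m) Q)) = s + 1" using fin Sm by (simp add: s_def)
        moreover have "(\<Sum>w\<in>insert (Suc m) Q. x w) = t ^ (n - m) + s * z"
          using fin Sm by (simp add: sumQ xpath)
        ultimately show ?thesis using 2 out(2) z_eq y_eq by (simp add: algebra_simps)
      next
        case 3
        then have "x w = z" using PQ uv by (auto simp: x_def)
        then show ?thesis using out(3)[OF 3] Q_eq by (simp add: sumP r_def)
      next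
        case 4
        then have "Suc n - w = Suc (n - w)" by simp
        then have "x w = t * t ^ (n - w)" "x (Suc w) = t ^ (n - w)"
          using 4 by (simp_all add: xpath)
        \<comment> \<open>The equation at \<open>n\<close>, scaled by
          \<open>t ^ (n - w)\<close>.\<close>
        then show ?thesis using out(4)[OF 4] arg_cong[OF t_eq, of "\<lambda>c. c * t ^ (n - w)"]
          by (simp add: algebra_simps)
      next
        case 5
        have "x n = t" using mn by (simp add: xpath)
        moreover have "x v = 1" using uv by (simp add: x_def)
        ultimately show ?thesis using 5 out(5) t_eq by simp
      qed
    qed
  qed (use G uv \<alpha> in auto)
qed

section \<open>Application to the two digraphs\<close>

text \<open>Induction on the number of inner vertices, with \<open>a\<close> arbitrary because
  removing the first arc leaves a walk that starts at \<open>Suc m\<close>. Case 0 contradicts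
  \<open>m < n\<close>; the recursion ends at \<open>Suc m = n\<close>.\<close>

lemma set_vwalk_arcs_path:
  assumes "m < n"
  shows "set (vwalk_arcs (a # [m + 1..<n + 1] @ [b])) =
    insert (a, Suc m) (insert (n, b) {(j, Suc j) |j. m < j \<and> j < n})"
  using assms
proof (induction "n - m" arbitrary: a m)
  case 0
  then show ?case by simp
next
  case (Suc k)
  have upt: "[m + 1..<n + 1] = Suc m # [Suc m + 1..<n + 1]"
    using Suc.prems by (simp add: upt_conv_Cons del: upt_Suc)
  show ?case
  proof (cases "Suc m = n")
    case True
    then show ?thesis by auto
  next
    case False
    then have "k = n - Suc m" "Suc m < n" using Suc by auto
    note IH = Suc.hyps(1)[OF this, of "Suc m"]
    have "set (vwalk_arcs (a # [m + 1..<n + 1] @ [b])) =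
        insert (a, Suc m) (set (vwalk_arcs (Suc m # [Suc m + 1..<n + 1] @ [b])))"
      unfolding upt by simp
    also have "\<dots> = insert (a, Suc m) (insert (n, b) {(j, Suc j) |j. m < j \<and> j < n})"
      unfolding IH using \<open>Suc m < n\<close> by (auto simp: not_less_eq less_Suc_eq)
    finally show ?thesis .
  qed
qed

lemma lambda_alpha_B1:
  assumes "0 \<le> \<alpha>" "\<alpha> < 1" "p \<ge> 2" "q \<ge> 2" "p + q < n"
    and "dominant_root \<alpha> (n - (p + q)) p q l"
  shows "lambda_alpha \<alpha> (B1 n p q) = l"
proof -
  have arcs: "parcs (B1 n p q) = {1..p} \<times> {p + 1..p + q} \<union> {p + 1..p + q} \<times> {1..p} \<union>
      insert (1, Suc (p + q)) (insert (n, p) {(j, Suc j) |j. p + q < j \<and> j < n})"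
    using set_vwalk_arcs_path[of "p + q" n 1 p] assms
    by (simp add: B1_def add_directed_path_def complete_bipartite_digraph_def)
  show ?thesis
    by (rule lambda_alpha_bipartite_with_path[where P = "{1..p}" and Q = "{p + 1..p + q}"
          and m = "p + q" and n = n and u = 1 and v = p])
      (use assms in \<open>auto simp: arcs pverts_B1 pair_digraph_B1\<close>)
qed

text \<open>Here the path is attached to the second part, which therefore takes the role of
  \<open>P\<close>; this swaps \<open>p\<close> and \<open>q\<close> in the root.\<close>

lemma lambda_alpha_B2:
  assumes "0 \<le> \<alpha>" "\<alpha> < 1" "p \<ge> 2" "q \<ge> 2" "p + q < n"
    and "dominant_root \<alpha> (n - (p + q)) q p l"
  shows "lambda_alpha \<alpha> (B2 n p q) = l"
proof -
  have arcs: "parcs (B2 n p q) = {1..p} \<times> {p + 1..p + q} \<union> {p + 1..p + q} \<times> {1..p} \<union>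
      insert (p + 1, Suc (p + q)) (insert (n, p + q) {(j, Suc j) |j. p + q < j \<and> j < n})"
    using set_vwalk_arcs_path[of "p + q" n "p + 1" "p + q"] assms
    by (simp add: B2_def add_directed_path_def complete_bipartite_digraph_def)
  show ?thesis
    by (rule lambda_alpha_bipartite_with_path[where P = "{p + 1..p + q}" and Q = "{1..p}"
          and m = "p + q" and n = n and u = "p + 1" and v = "p + q"])
      (use assms in \<open>auto simp: arcs pverts_B2 pair_digraph_B2\<close>)
qed

theorem theorem4p3:
  fixes \<alpha> :: real and n p q :: nat
  assumes "0 \<le> \<alpha>" and "\<alpha> < 1"
    and "p \<ge> q" and "q \<ge> 2"
    and "p + q \<le> n - 1"
  shows "lambda_alpha \<alpha> (B2 n p q) \<ge> lambda_alpha \<alpha> (B1 n p q) \<and>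
    (lambda_alpha \<alpha> (B2 n p q) = lambda_alpha \<alpha> (B1 n p q) \<longleftrightarrow> p = q)"
proof -
  have p: "p \<ge> 2" and n: "p + q < n" using assms by auto
  define k where "k = n - (p + q)"
  obtain l m where l: "dominant_root \<alpha> k p q l" and m: "dominant_root \<alpha> k q p m"
    using dominant_root_exists[of \<alpha> p q k] dominant_root_exists[of \<alpha> q p k] assms p by auto
  have B1: "lambda_alpha \<alpha> (B1 n p q) = l"
    using lambda_alpha_B1 assms p n l by (simp add: k_def)
  \<comment> \<open>Stated for every root, since for \<open>p = q\<close> it is applied to
    \<open>l\<close>, which then solves both equations.\<close>
  have B2: "lambda_alpha \<alpha> (B2 n p q) = m'" if "dominant_root \<alpha> k q p m'" for m'
    using lambda_alpha_B2 assms p n that by (simp add: k_def)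
  show ?thesis
  proof (cases "p = q")
    case True
    then show ?thesis using B1 B2[of l] l by simp
  next
    case False
    then have "l < m" using dominant_root_swap_less[OF _ _ _ _ l m] assms by simp
    then show ?thesis using False B1 B2[OF m] by simp
  qed
qed

end
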